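(* Suppose that, in addition to increments, the weight of edges may also be decremented by integer amounts. Then for every $n\in\mathbb{N}$ there exist a directed graph $G$ with $n$ vertices, a weight function $w:E(G)\to\mathbb{Z}$ and a source vertex $s$ such that every $1$-WTSS of $G$ in this model (with respect to $s$) must contain at least $c\cdot n^2$ edges, for some constant $c>0$.
   Context: For a directed graph $G$ with edge weights $w$, $dist_{G,w}(x,y)$ is the minimum weight of an $x$–$y$ path. In this relaxed model, given $G$, $w:E(G)\to\mathbb{Z}$, a source $s$ and $k\ge1$, a subgraph $H=(V(G),E')$ with $E'\subseteq E(G)$ is a $k$-WTSS of $G$ if for every change function $I:E(G)\to\mathbb{Z}$ (entries may be negative) with $\sum_{e\in E(G)} |I(e)|\le k$, setting $w'(e)=w(e)+I(e)$, one has $dist_{G,w'}(s,t)=dist_{H,w'}(s,t)$ for every $t\in V(G)$.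
   Formalization: The claim is proved for every n ≥ 2 rather than every natural number n: for n = 0 there is no source vertex, and for n = 1 the edgeless subgraph is a 1-WTSS, so a bound of c·n² > 0 edges is false. *)

theory Defs
  imports Complex_Main "Graph_Theory.Graph_Theory"
begin

(* The infimum ranges over vertex-simple paths (apath), not over walks as in the library
   constant for shortest walks: integer weights may create negative cycles, and only for
   simple paths is the minimum always attained.  In a finite digraph the infimum is over a
   finite set, so it is the minimum; it is \<infinity> if y is not reachable from x. *)
definition path_dist :: "('a, 'b) pre_digraph \<Rightarrow> ('b \<Rightarrow> int) \<Rightarrow> 'a \<Rightarrow> 'a \<Rightarrow> ereal" where
  "path_dist G w x y =
    (INF p \<in> {p. pre_digraph.apath G x p y}.
       ereal (wf_digraph.awalk_cost (\<lambda>e. real_of_int (w e)) p))"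

(* Weight and change functions are total on the arc type; only their values on arcs G matter,
   since arcs H \<subseteq> arcs G. *)
definition is_WTSS ::
  "nat \<Rightarrow> ('a, 'b) pre_digraph \<Rightarrow> ('b \<Rightarrow> int) \<Rightarrow> 'a \<Rightarrow> ('a, 'b) pre_digraph \<Rightarrow> bool" where
  "is_WTSS k G w s H \<longleftrightarrow>
     spanning H G \<and>
     (\<forall>I :: 'b \<Rightarrow> int. (\<Sum>e\<in>arcs G. \<bar>I e\<bar>) \<le> int k \<longrightarrow>
        (\<forall>t\<in>verts G. path_dist G (\<lambda>e. w e + I e) s t = path_dist H (\<lambda>e. w e + I e) s t))"

end

theory Submission
  imports Defs
begin

text \<open>
  Split the vertices \<open>{0..<n}\<close> into \<open>{0..<m}\<close> and \<open>{m..<n}\<close> with \<open>m = n div 2\<close>, join the source 0 to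
  every other vertex of the first part, and every vertex of the first part to every vertex of the
  second, all with weight 0. Decrementing \<open>(0, a)\<close> by 1 makes \<open>0 \<rightarrow> a \<rightarrow> b\<close> the unique shortest
  path from 0 to \<open>b\<close>, so a 1-WTSS must contain \<open>(a, b)\<close>; decrementing \<open>(0, b)\<close> forces \<open>(0, b)\<close>.
  Hence all \<open>m (n - m)\<close> arcs between the two parts are needed.
\<close>

definition fan_digraph :: "nat \<Rightarrow> nat \<Rightarrow> (nat, nat \<times> nat) pre_digraph" where
  "fan_digraph m n =
    \<lparr>verts = {0..<n}, arcs = {0} \<times> {1..<m} \<union> {0..<m} \<times> {m..<n}, tail = fst, head = snd\<rparr>"

lemma fan_digraph_simps [simp]:
  "verts (fan_digraph m n) = {0..<n}"
  "arcs (fan_digraph m n) = {0} \<times> {1..<m} \<union> {0..<m} \<times> {m..<n}"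
  "tail (fan_digraph m n) = fst"
  "head (fan_digraph m n) = snd"
  by (simp_all add: fan_digraph_def)

text \<open>Arcs are their own endpoint pairs, which excludes parallel arcs. Starting
  \<open>{1..<m}\<close> at 1 excludes a loop at 0.\<close>

lemma digraph_fan_digraph:
  assumes "0 < m" "m \<le> n"
  shows "digraph (fan_digraph m n)"
  using assms by unfold_locales (auto simp: arc_to_ends_def)

text \<open>The summand \<open>0 +\<close> is the zero weight, kept so that the equation matches
  \<open>w e + I e\<close> when \<open>path_dist\<close> is unfolded.\<close>

lemma (in wf_digraph) awalk_cost_decrement:
  "awalk_cost (\<lambda>e'. real_of_int (0 + (if e' = e then - 1 else 0))) p = - real (count_list p e)"
  by (induction p) auto

text \<open>After \<open>e\<close> alone is decremented, a path has negative cost exactly if it uses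
  \<open>e\<close>. So \<open>p\<close> makes the distance to \<open>t\<close> negative in
  \<open>G\<close>, hence in \<open>H\<close>, and some path in \<open>H\<close> must use
  \<open>e\<close>.\<close>

lemma is_WTSS_zero_weight_path:
  assumes "digraph G" "is_WTSS 1 G (\<lambda>_. 0) s H"
    and p: "pre_digraph.apath G s p t" and "e \<in> set p"
  obtains q where "pre_digraph.apath G s q t" "e \<in> set q" "set q \<subseteq> arcs H"
proof -
  interpret digraph G by fact
  let ?I = "\<lambda>e'. if e' = e then - 1 else 0 :: int"
  have sub: "subgraph H G" and dist:
    "\<And>I t. (\<Sum>e\<in>arcs G. \<bar>I e\<bar>) \<le> 1 \<Longrightarrow> t \<in> verts G \<Longrightarrow>
      path_dist G (\<lambda>e. 0 + I e) s t = path_dist H (\<lambda>e. 0 + I e) s t"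
    using assms(2) by (auto simp: is_WTSS_def spanning_def)
  have "\<bar>?I e'\<bar> = (if e' = e then 1 else 0)" for e'
    by simp
  then have "(\<Sum>e'\<in>arcs G. \<bar>?I e'\<bar>) \<le> 1"
    by simp
  moreover have "t \<in> verts G"
    using p by (auto simp: apath_def)
  ultimately have "path_dist H (\<lambda>e. 0 + ?I e) s t = path_dist G (\<lambda>e. 0 + ?I e) s t"
    by (simp only: dist)
  also have "\<dots> \<le> ereal (- real (count_list p e))"
    unfolding path_dist_def awalk_cost_decrement using p by (intro INF_lower) simp
  also have "\<dots> < 0"
    using \<open>e \<in> set p\<close> by (auto simp: count_list_0_iff simp flip: neq0_conv)
  \<comment> \<open>An empty infimum would be \<infinity>, so a value below 0 also shows that
    \<open>H\<close> has a path to \<open>t\<close>.\<close>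
  finally obtain q where q: "pre_digraph.apath H s q t" "count_list q e \<noteq> 0"
    unfolding path_dist_def awalk_cost_decrement by (auto simp: INF_less_iff)
  have "apath s q t"
    using sub q(1) by (rule subgraph_apath_imp_apath[rotated])
  moreover have "e \<in> set q"
    using q(2) by (metis count_list_0_iff)
  moreover have "set q \<subseteq> arcs H"
    using q(1) by (auto simp: pre_digraph.apath_def pre_digraph.awalk_def)
  ultimately show thesis ..
qed

lemma fan_digraph_necessary_arcs:
  assumes "0 < m" "m \<le> n" and H: "is_WTSS 1 (fan_digraph m n) (\<lambda>_. 0) 0 H"
  shows "{0..<m} \<times> {m..<n} \<subseteq> arcs H"
proof clarify
  fix a b assume ab: "a \<in> {0..<m}" "b \<in> {m..<n}"
  interpret digraph "fan_digraph m n"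
    using assms by (intro digraph_fan_digraph)
  show "(a, b) \<in> arcs H"
  proof (cases "a = 0")
    case True
    have "apath 0 [(0, b)] b"
      using ab by (auto simp: apath_simps)
    then obtain q where "(0, b) \<in> set q" "set q \<subseteq> arcs H"
      by (rule is_WTSS_zero_weight_path[OF digraph_axioms H, where e = "(0, b)"]) auto
    with True show ?thesis by auto
  next
    case False
    have "apath 0 [(0, a), (a, b)] b"
      using ab False by (auto simp: apath_simps)
    then obtain q where q: "apath 0 q b" "(0, a) \<in> set q" "set q \<subseteq> arcs H"
      by (rule is_WTSS_zero_weight_path[OF digraph_axioms H, where e = "(0, a)"]) auto
    text \<open>No arc enters 0, and no arc leaves the second part.\<close>
    have no_return: "(0, a) \<notin> set r" if "awalk x r b" "x \<noteq> 0" for x r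
      using that by (induction r arbitrary: x) (fastforce simp: awalk_simps)+
    \<comment> \<open>The first arc of \<open>q\<close> leads away from 0, so by
      \<open>no_return\<close> the arc \<open>(0, a)\<close> can only be that first arc.\<close>
    obtain r where "q = (0, a) # r" "awalk a r b"
      using q(1,2) no_return by (cases q) (auto simp: apath_def awalk_simps)
    \<comment> \<open>Since \<open>a < m \<le> b\<close>, the walk \<open>r\<close> is nonempty;
      since \<open>a\<close> is not 0, its arcs out of \<open>a\<close> all end in the second
      part.\<close>
    moreover from this obtain x r' where "r = (a, x) # r'" "awalk x r' b" "x \<ge> m"
      using ab False by (cases r) (auto simp: awalk_simps)
    moreover from this have "x = b"
      by (cases r') (fastforce simp: awalk_simps)+
    ultimately show ?thesis using q(3) by auto
  qed
qed

text \<open>The factor 4, rather than 2, absorbs the rounding down in \<open>n div 2\<close>; with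
  the factor 2 for the other half this gives 1/8.\<close>

lemma half_split_ge:
  assumes "n \<ge> 2"
  shows "real ((n div 2) * (n - n div 2)) \<ge> 1/8 * (real n)\<^sup>2"
proof -
  have "4 * (n div 2) \<ge> n" "2 * (n - n div 2) \<ge> n"
    using assms by linarith+
  then have "n * n \<le> (4 * (n div 2)) * (2 * (n - n div 2))"
    by (intro mult_mono) auto
  also have "\<dots> = 8 * ((n div 2) * (n - n div 2))"
    by simp
  finally have "real (n * n) \<le> real (8 * ((n div 2) * (n - n div 2)))"
    by (simp only: of_nat_le_iff)
  then show ?thesis
    by (simp add: power2_eq_square)
qed

theorem theorem7:
  shows "\<exists>c::real. c > 0 \<and>
    (\<forall>n::nat. n \<ge> 2 \<longrightarrow>
      (\<exists>(G :: (nat, nat \<times> nat) pre_digraph) (w :: nat \<times> nat \<Rightarrow> int) (s :: nat).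
         digraph G \<and> card (verts G) = n \<and> s \<in> verts G \<and>
         (\<forall>H. is_WTSS 1 G w s H \<longrightarrow> real (card (arcs H)) \<ge> c * (real n)\<^sup>2)))"
proof (rule exI[of _ "1/8"], intro conjI allI impI)
  fix n :: nat assume n: "n \<ge> 2"
  define m where "m = n div 2"
  have m: "0 < m" "m \<le> n"
    using n by (auto simp: m_def)
  have "real (card (arcs H)) \<ge> 1/8 * (real n)\<^sup>2"
    if H: "is_WTSS 1 (fan_digraph m n) (\<lambda>_. 0) 0 H" for H
  proof -
    have "arcs H \<subseteq> arcs (fan_digraph m n)"
      using H by (auto simp: is_WTSS_def spanning_def simp del: fan_digraph_simps)
    \<comment> \<open>An infinite set has \<open>card\<close> 0, so the lower bound on
      \<open>card\<close> needs finiteness.\<close>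
    then have "finite (arcs H)"
      by (rule finite_subset) simp
    then have "m * (n - m) \<le> card (arcs H)"
      using card_mono[OF _ fan_digraph_necessary_arcs[OF m H]] by simp
    then show ?thesis
      using half_split_ge[OF n] unfolding m_def by linarith
  qed
  then show "\<exists>(G :: (nat, nat \<times> nat) pre_digraph) (w :: nat \<times> nat \<Rightarrow> int) (s :: nat).
         digraph G \<and> card (verts G) = n \<and> s \<in> verts G \<and>
         (\<forall>H. is_WTSS 1 G w s H \<longrightarrow> real (card (arcs H)) \<ge> 1/8 * (real n)\<^sup>2)"
    using digraph_fan_digraph[OF m] n
    by (intro exI[of _ "fan_digraph m n"] exI[of _ "\<lambda>_. 0"] exI[of _ 0]) auto
qed simp

end
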